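(* Let $q$ be even, $G=\mathrm{SO}_{2m+1}(q)\cong\mathrm{Sp}_{2m}(q)$ acting on $V$ with nonsingular quadratic form $Q$, and let $g\in G$ be semisimple with $\dim C_V(g)\geq 2$. Then $g$ stabilizes a nondegenerate hyperplane of plus type and a nondegenerate hyperplane of minus type.
   Context: $V$ is a $(2m+1)$-dimensional $\mathbb F_q$-space and $Q$ is nonsingular, i.e. no nonzero vector of the radical $V^\perp$ of the associated bilinear form is singular; $V^\perp$ is $1$-dimensional and $G$ (the isometry group of $Q$) acts trivially on it. A nondegenerate hyperplane is a complement $W$ of $V^\perp$; $Q|_W$ is then nondegenerate and $W$ has a type (plus or minus, according to its Witt index). Stabilizers of nondegenerate hyperplanes of type $\pm$ correspond to the subgroups $\mathrm{SO}^{\pm}_{2m}(q)<\mathrm{Sp}_{2m}(q)$. *)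

theory Defs
  imports "HOL-Analysis.Analysis" "HOL-Computational_Algebra.Polynomial"
    "HOL-Computational_Algebra.Squarefree"
begin

text \<open>Vectors of V are elements of 'a^'n ('a a finite field, 'n a finite index type);
  the group elements are matrices acting by (*v).\<close>

definition polar_form :: "('a::field^'n \<Rightarrow> 'a) \<Rightarrow> 'a^'n \<Rightarrow> 'a^'n \<Rightarrow> 'a" where
  "polar_form Q u v = Q (u + v) - Q u - Q v"

definition quadratic_form :: "('a::field^'n \<Rightarrow> 'a) \<Rightarrow> bool" where
  "quadratic_form Q \<longleftrightarrow>
     (\<forall>c v. Q (c *s v) = c^2 * Q v) \<and>
     (\<forall>u v w. polar_form Q (u + v) w = polar_form Q u w + polar_form Q v w) \<and>
     (\<forall>c u w. polar_form Q (c *s u) w = c * polar_form Q u w)"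

text \<open>Radical V-perp of the associated bilinear form.\<close>
definition radical :: "('a::field^'n \<Rightarrow> 'a) \<Rightarrow> ('a^'n) set" where
  "radical Q = {v. \<forall>u. polar_form Q v u = 0}"

text \<open>Nonsingular: no nonzero vector of the radical is singular.\<close>
definition nonsingular_qf :: "('a::field^'n \<Rightarrow> 'a) \<Rightarrow> bool" where
  "nonsingular_qf Q \<longleftrightarrow> (\<forall>v\<in>radical Q. v \<noteq> 0 \<longrightarrow> Q v \<noteq> 0)"

text \<open>Isometry group of Q (in characteristic 2 and odd dimension this is SO(Q)).\<close>
definition isometry_group :: "('a::field^'n \<Rightarrow> 'a) \<Rightarrow> ('a^'n^'n) set" where
  "isometry_group Q = {g. invertible g \<and> (\<forall>v. Q (g *v v) = Q v)}"

text \<open>Evaluation of a polynomial at a matrix, applied to a vector.\<close>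
definition poly_mat_apply :: "'a::field poly \<Rightarrow> 'a^'n^'n \<Rightarrow> 'a^'n \<Rightarrow> 'a^'n" where
  "poly_mat_apply p g v = (\<Sum>i\<le>degree p. coeff p i *s (((*v) g) ^^ i) v)"

text \<open>Semisimple: the minimal polynomial has no repeated factors, i.e. g is
  annihilated by a nonzero squarefree polynomial (over a perfect field this is
  separability, i.e. diagonalisability over the algebraic closure).\<close>
definition semisimple :: "'a::field^'n^'n \<Rightarrow> bool" where
  "semisimple g \<longleftrightarrow> (\<exists>p. p \<noteq> 0 \<and> squarefree p \<and> (\<forall>v. poly_mat_apply p g v = 0))"

text \<open>Fixed space C_V(g).\<close>
definition fixed_space :: "'a::field^'n^'n \<Rightarrow> ('a^'n) set" where
  "fixed_space g = {v. g *v v = v}"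

text \<open>Nondegenerate hyperplane: a (subspace) complement of the radical.\<close>
definition nondeg_hyperplane :: "('a::field^'n \<Rightarrow> 'a) \<Rightarrow> ('a^'n) set \<Rightarrow> bool" where
  "nondeg_hyperplane Q W \<longleftrightarrow> vec.subspace W \<and> W \<inter> radical Q = {0} \<and>
     {w + r | w r. w \<in> W \<and> r \<in> radical Q} = UNIV"

definition totally_singular :: "('a::field^'n \<Rightarrow> 'a) \<Rightarrow> ('a^'n) set \<Rightarrow> bool" where
  "totally_singular Q U \<longleftrightarrow> vec.subspace U \<and> (\<forall>u\<in>U. Q u = 0)"

text \<open>Witt index of Q restricted to W: maximal dimension of a totally singular subspace of W.\<close>
definition witt_index :: "('a::field^'n \<Rightarrow> 'a) \<Rightarrow> ('a^'n) set \<Rightarrow> nat" where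
  "witt_index Q W = Max {vec.dim U | U. U \<subseteq> W \<and> totally_singular Q U}"

definition plus_type :: "('a::field^'n \<Rightarrow> 'a) \<Rightarrow> ('a^'n) set \<Rightarrow> bool" where
  "plus_type Q W \<longleftrightarrow> 2 * witt_index Q W = vec.dim W"

definition minus_type :: "('a::field^'n \<Rightarrow> 'a) \<Rightarrow> ('a^'n) set \<Rightarrow> bool" where
  "minus_type Q W \<longleftrightarrow> 2 * witt_index Q W + 2 = vec.dim W"

end

theory Submission
  imports Defs
begin

(* In characteristic 2 the radical of Q is a line spanned by a vector r with Q r <> 0, and the
   isometry g fixes r. Semisimplicity gives V = C_V(g) + [V,g], the two summands orthogonal and
   meeting trivially; as dim C_V(g) >= 2, some u in C_V(g) lies outside the radical, and pairing
   it against C_V(g) gives c in C_V(g) with B(u,c) = 1. Then R = <u,c>^perp contains r and [V,g],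
   and for a complement Y of r in R containing [V,g] every W = <u + a r, c + b r> + Y is a
   nondegenerate g-invariant hyperplane. As squaring is onto, the values Q(u + a r) and
   Q(c + b r) are arbitrary, and an induction on dim Y (splitting off hyperbolic planes until 0
   or an anisotropic plane is left) shows that suitable values make the Witt index of W either
   maximal or one less. *)

lemma even_card_if_fixpoint_free_involution:
  assumes "finite A" "\<And>x. x \<in> A \<Longrightarrow> s x \<in> A" "\<And>x. x \<in> A \<Longrightarrow> s (s x) = x"
    "\<And>x. x \<in> A \<Longrightarrow> s x \<noteq> x"
  shows "even (card A)"
  using assms
proof (induction "card A" arbitrary: A rule: less_induct)
  case less
  note fin = less(2) and closed = less(3) and invol = less(4) and no_fix = less(5)
  show ?case
  proof (cases "A = {}")
    case False
    then obtain x where x: "x \<in> A" by blast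
    let ?A = "A - {x, s x}"
    have pair: "card {x, s x} = 2" "{x, s x} \<subseteq> A" using no_fix[OF x] closed[OF x] x by auto
    then have card_A: "card A = card ?A + 2"
      using card_Diff_subset[OF _ pair(2)] card_mono[OF fin pair(2)] by simp
    have "even (card ?A)"
    proof (rule less(1))
      fix y assume "y \<in> ?A"
      then have y: "y \<in> A" "y \<noteq> x" "y \<noteq> s x" by auto
      have "s y \<noteq> x" using invol[OF y(1)] y(3) by auto
      moreover have "s y \<noteq> s x" using invol[OF y(1)] invol[OF x] y(2) by metis
      ultimately show "s y \<in> ?A" using closed[OF y(1)] by simp
      show "s (s y) = y" "s y \<noteq> y" using invol[OF y(1)] no_fix[OF y(1)] by auto
    qed (use fin card_A in auto)
    then show ?thesis using card_A by simp
  qed simp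
qed

lemma two_eq_zero_if_even_card:
  assumes "even CARD('a::{field,finite})"
  shows "(2::'a) = 0"
proof (rule ccontr)
  assume two: "(2::'a) \<noteq> 0"
  have "- x \<noteq> x" if "x \<noteq> 0" for x :: 'a
  proof
    assume "- x = x"
    then have "2 * x = 0" by (metis add.inverse_inverse mult_2 neg_eq_iff_add_eq_0)
    then show False using two that by simp
  qed
  then have "even (card (UNIV - {0::'a}))"
    by (intro even_card_if_fixpoint_free_involution[where s = uminus]) auto
  moreover have "card (UNIV - {0::'a}) = CARD('a) - 1" by (simp add: card_Diff_subset)
  moreover have "CARD('a) > 0" by (simp add: card_gt_0_iff)
  ultimately show False using assms by (cases "CARD('a)") auto
qed

definition plane_sum :: "'a::field^'n \<Rightarrow> 'a^'n \<Rightarrow> ('a^'n) set \<Rightarrow> ('a^'n) set" where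
  "plane_sum e f X = {a *s e + b *s f + x | a b x. x \<in> X}"

lemma plane_sum_eq_span:
  assumes "vec.subspace X"
  shows "plane_sum e f X = vec.span (insert e (insert f X))"
proof (intro set_eqI iffI)
  fix y assume "y \<in> plane_sum e f X"
  then obtain a b x where "y = a *s e + b *s f + x" "x \<in> X" unfolding plane_sum_def by blast
  then show "y \<in> vec.span (insert e (insert f X))"
    by (auto intro!: vec.span_add vec.span_scale intro: vec.span_base)
next
  fix y assume "y \<in> vec.span (insert e (insert f X))"
  then obtain a b where "y - a *s e - b *s f \<in> X"
    unfolding vec.span_insert vec.span_eq_iff[THEN iffD2, OF assms] by blast
  moreover have "y = a *s e + b *s f + (y - a *s e - b *s f)" by simp
  ultimately show "y \<in> plane_sum e f X" unfolding plane_sum_def by blast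
qed

lemma subspace_plane_sum: "vec.subspace X \<Longrightarrow> vec.subspace (plane_sum e f X)"
  by (simp add: plane_sum_eq_span)

lemma subset_plane_sum: "vec.subspace X \<Longrightarrow> X \<subseteq> plane_sum e f X"
  by (auto simp: plane_sum_eq_span intro: vec.span_base)

lemma plane_sum_commute: "plane_sum p q (plane_sum e f X) = plane_sum e f (plane_sum p q X)"
proof -
  have swap: "a *s p + b *s q + (c *s e + d *s f + x) = c *s e + d *s f + (a *s p + b *s q + x)"
    for a b c d and x :: "'a::field^'b"
    by (simp add: algebra_simps)
  show ?thesis
  proof (intro set_eqI iffI)
    fix y assume "y \<in> plane_sum p q (plane_sum e f X)"
    then obtain a b c d x where "y = a *s p + b *s q + (c *s e + d *s f + x)" "x \<in> X"
      unfolding plane_sum_def by blast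
    then show "y \<in> plane_sum e f (plane_sum p q X)" unfolding plane_sum_def swap by blast
  next
    fix y assume "y \<in> plane_sum e f (plane_sum p q X)"
    then obtain a b c d x where "y = c *s e + d *s f + (a *s p + b *s q + x)" "x \<in> X"
      unfolding plane_sum_def by blast
    then show "y \<in> plane_sum p q (plane_sum e f X)" unfolding plane_sum_def swap[symmetric] by blast
  qed
qed

lemma plane_sum_plane_sum_zero: "plane_sum e f (plane_sum g h {0}) = vec.span {e, f, g, h}"
proof -
  have "plane_sum e f (plane_sum g h {0}) = vec.span (insert e (insert f (vec.span {g, h, 0})))"
    by (simp add: plane_sum_eq_span)
  also have "\<dots> = vec.span {e, f, g, h}"
    unfolding vec.span_eq
  proof
    have "vec.span {g, h, 0} \<subseteq> vec.span {e, f, g, h}"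
      by (rule vec.span_minimal) (auto intro: vec.span_base simp: vec.span_zero)
    then show "insert e (insert f (vec.span {g, h, 0})) \<subseteq> vec.span {e, f, g, h}"
      by (auto intro: vec.span_base)
    have "g \<in> vec.span {g, h, 0}" "h \<in> vec.span {g, h, 0}" by (auto intro: vec.span_base)
    then show "{e, f, g, h} \<subseteq> vec.span (insert e (insert f (vec.span {g, h, 0})))"
      by (auto intro: vec.span_base)
  qed
  finally show ?thesis .
qed

lemma dim_le_dim_kernel_plus_one:
  fixes \<phi> :: "'a::field^'n \<Rightarrow> 'a"
  assumes U: "vec.subspace U"
    and add: "\<And>x y. \<phi> (x + y) = \<phi> x + \<phi> y" and scale: "\<And>c x. \<phi> (c *s x) = c * \<phi> x"
  shows "vec.dim U \<le> vec.dim {u \<in> U. \<phi> u = 0} + 1"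
proof (cases "\<exists>u0\<in>U. \<phi> u0 \<noteq> 0")
  case False
  then have "U = {u \<in> U. \<phi> u = 0}" by auto
  then show ?thesis by simp
next
  case True
  then obtain u0 where u0: "u0 \<in> U" "\<phi> u0 \<noteq> 0" by blast
  let ?K = "{u \<in> U. \<phi> u = 0}"
  have "U \<subseteq> vec.span (insert u0 ?K)"
  proof
    fix u assume u: "u \<in> U"
    let ?k = "\<phi> u / \<phi> u0"
    have "\<phi> (u + (- ?k) *s u0) = 0" using u0(2) by (simp only: add scale) simp
    moreover have "u + (- ?k) *s u0 \<in> U" using u u0 U by (intro vec.subspace_add vec.subspace_scale)
    ultimately have "u + (- ?k) *s u0 \<in> vec.span ?K" by (intro vec.span_base) simp
    then have "u - ?k *s u0 \<in> vec.span ?K" by simp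
    then show "u \<in> vec.span (insert u0 ?K)" unfolding vec.span_insert by blast
  qed
  then have "vec.dim U \<le> vec.dim (insert u0 ?K)" by (metis vec.dim_span vec.dim_subset)
  also have "\<dots> \<le> vec.dim ?K + 1" by (simp add: vec.dim_insert)
  finally show ?thesis .
qed

lemma exists_complement_containing:
  assumes D: "vec.subspace D" and R: "vec.subspace R" and "D \<subseteq> R" "r \<in> R" "r \<notin> D"
  obtains Y where "vec.subspace Y" "D \<subseteq> Y" "Y \<subseteq> R" "r \<notin> Y" "R \<subseteq> vec.span (insert r Y)"
proof -
  obtain BD where BD: "BD \<subseteq> D" "vec.independent BD" "D \<subseteq> vec.span BD" "card BD = vec.dim D"
    by (rule vec.basis_exists[of D])
  have "vec.span BD \<subseteq> D" using BD(1) D by (rule vec.span_minimal)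
  then have r_BD: "r \<notin> vec.span BD" using \<open>r \<notin> D\<close> by blast
  have "insert r BD \<subseteq> R" using BD(1) assms(3,4) by blast
  moreover have "vec.independent (insert r BD)" using r_BD BD(2) by (rule vec.independent_insertI)
  ultimately obtain BR where BR: "insert r BD \<subseteq> BR" "BR \<subseteq> R" "vec.independent BR" "R \<subseteq> vec.span BR"
    by (rule vec.maximal_independent_subset_extend)
  show ?thesis
  proof
    let ?Y = "vec.span (BR - {r})"
    show "vec.subspace ?Y" by simp
    have "BD \<subseteq> BR - {r}" using BR(1) r_BD vec.span_base by blast
    then show "D \<subseteq> ?Y" using BD(3) vec.span_mono by blast
    show "?Y \<subseteq> R" using BR(2) R by (intro vec.span_minimal) auto
    show "r \<notin> ?Y" using BR(1,3) unfolding vec.dependent_def by blast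
    have "BR \<subseteq> insert r ?Y"
    proof
      fix x assume "x \<in> BR"
      then show "x \<in> insert r ?Y" by (cases "x = r") (simp_all add: vec.span_base)
    qed
    then show "R \<subseteq> vec.span (insert r ?Y)" using BR(4) vec.span_mono by blast
  qed
qed

lemma subspace_range_displacement: "vec.subspace (range (\<lambda>w. g *v w - w))"
  unfolding vec.subspace_def
proof (intro conjI ballI allI)
  show "0 \<in> range (\<lambda>w. g *v w - w)" by (rule range_eqI[of _ _ 0]) simp
  fix x y assume "x \<in> range (\<lambda>w. g *v w - w)" "y \<in> range (\<lambda>w. g *v w - w)"
  then obtain wx wy where "x = g *v wx - wx" "y = g *v wy - wy" by blast
  then have "x + y = g *v (wx + wy) - (wx + wy)" by (simp add: matrix_vector_right_distrib)
  then show "x + y \<in> range (\<lambda>w. g *v w - w)" by blast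
next
  fix a x assume "x \<in> range (\<lambda>w. g *v w - w)"
  then obtain w where "x = g *v w - w" by blast
  then have "a *s x = g *v (a *s w) - a *s w" by (simp add: vec.scale vec.scale_right_diff_distrib)
  then show "a *s x \<in> range (\<lambda>w. g *v w - w)" by blast
qed

lemma image_eq_if_displacements_in:
  fixes g :: "'a::{field,finite}^'n^'n"
  assumes "invertible g" "vec.subspace W" "\<And>w. w \<in> W \<Longrightarrow> g *v w - w \<in> W"
  shows "(\<lambda>v. g *v v) ` W = W"
proof -
  obtain h where h: "h ** g = mat 1" using assms(1) unfolding invertible_def by blast
  have "inj ((*v) g)"
  proof (rule injI)
    fix x y assume "g *v x = g *v y"
    then show "x = y" using arg_cong[of _ _ "(*v) h"] h by (metis matrix_vector_mul_assoc matrix_vector_mul_lid)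
  qed
  then have "card ((\<lambda>v. g *v v) ` W) = card W" by (simp add: card_image inj_on_subset)
  moreover have "(\<lambda>v. g *v v) ` W \<subseteq> W"
  proof
    fix x assume "x \<in> (\<lambda>v. g *v v) ` W"
    then obtain w where w: "w \<in> W" "x = g *v w" by blast
    then have "w + (g *v w - w) \<in> W" using vec.subspace_add[OF assms(2)] assms(3) by blast
    then show "x \<in> W" using w(2) by simp
  qed
  ultimately show ?thesis by (metis card_subset_eq finite)
qed

locale char2_quadratic_form =
  fixes Q :: "'a::{field,finite}^'n \<Rightarrow> 'a"
  assumes quadratic: "quadratic_form Q" and two_eq_zero: "(2::'a) = 0"
begin

abbreviation "B \<equiv> polar_form Q"

lemma quadratic_scale: "Q (c *s v) = c^2 * Q v"
  using quadratic unfolding quadratic_form_def by blast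

lemma polar_add_left: "B (u + v) w = B u w + B v w"
  using quadratic unfolding quadratic_form_def by blast

lemma polar_scale_left: "B (c *s u) w = c * B u w"
  using quadratic unfolding quadratic_form_def by blast

lemma polar_commute: "B u v = B v u"
  unfolding polar_form_def by (simp add: add.commute)

lemma quadratic_zero [simp]: "Q 0 = 0"
  using quadratic_scale[of 0 0] by simp

lemma polar_zero [simp]: "B 0 v = 0" "B v 0 = 0"
  unfolding polar_form_def by simp_all

lemma polar_simps [simp]:
  "B (u + v) w = B u w + B v w" "B w (u + v) = B w u + B w v"
  "B (c *s u) w = c * B u w" "B w (c *s u) = c * B w u"
  using polar_add_left polar_scale_left polar_commute by metis+

lemma quadratic_simps [simp]: "Q (u + v) = Q u + Q v + B u v" "Q (c *s v) = c^2 * Q v"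
  unfolding polar_form_def by (simp_all add: quadratic_scale)

lemma uminus_char2 [simp]: "- (x::'a) = x"
  using two_eq_zero by (metis add.inverse_unique mult_2 mult_zero_left)

lemma diff_char2 [simp]: "(x::'a) - y = x + y"
  by (metis diff_conv_add_uminus uminus_char2)

lemma add_self_char2 [simp]: "(x::'a) + x = 0"
  by (metis diff_char2 diff_self)

lemma add_eq_0_iff_char2 [simp]: "((x::'a) + y = 0) = (x = y)"
  by (metis add_self_char2 add.assoc add.right_neutral add.commute)

lemma two_times_char2 [simp]: "2 * (x::'a) = 0" "(x::'a) * 2 = 0"
  using two_eq_zero by simp_all

lemma uminus_vec_char2 [simp]: "- (v::'a^'n) = v"
  by (simp add: vec_eq_iff)

lemma diff_vec_char2 [simp]: "(u::'a^'n) - v = u + v"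
  by (metis diff_conv_add_uminus uminus_vec_char2)

lemma add_self_vec_char2 [simp]: "(v::'a^'n) + v = 0"
  by (metis diff_vec_char2 diff_self)

lemma add_eq_0_iff_vec_char2 [simp]: "((u::'a^'n) + v = 0) = (u = v)"
  by (metis add_self_vec_char2 add.assoc add.right_neutral add.commute)

lemma two_times_vec_char2 [simp]: "2 * (v::'a^'n) = 0" "(v::'a^'n) * 2 = 0"
  by (simp_all add: vec_eq_iff numeral_2_eq_2)

lemma polar_self [simp]: "B v v = 0"
  using quadratic_simps(1)[of v v] by simp

lemma square_add: "((x::'a) + y)^2 = x^2 + y^2"
  by (simp add: power2_eq_square algebra_simps)

lemma square_inj: "(x::'a)^2 = y^2 \<Longrightarrow> x = y"
proof -
  assume "x^2 = y^2"
  then have "(x + y)^2 = 0" by (simp add: square_add)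
  then show "x = y" by simp
qed

lemma exists_square_root: "\<exists>y. y^2 = (x::'a)"
proof -
  have "inj (\<lambda>y::'a. y^2)" by (auto intro: injI square_inj)
  then have "surj (\<lambda>y::'a. y^2)" using finite_UNIV_inj_surj[of "\<lambda>y::'a. y^2"] by simp
  then obtain y where "x = y^2" unfolding surj_def by blast
  then show ?thesis by blast
qed

lemma exists_not_artin_schreier: "\<exists>c::'a. \<forall>t. t^2 + t \<noteq> c"
proof (rule ccontr)
  assume "\<not> ?thesis"
  then have "surj (\<lambda>t::'a. t^2 + t)" unfolding surj_def by metis
  then have "inj (\<lambda>t::'a. t^2 + t)" using finite_UNIV_surj_inj[of "\<lambda>t::'a. t^2 + t"] by simp
  moreover have "(0::'a)^2 + 0 = 1^2 + 1" by simp
  ultimately have "(0::'a) = 1" unfolding inj_def by blast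
  then show False by simp
qed

definition nondeg :: "('a^'n) set \<Rightarrow> bool" where
  "nondeg S \<longleftrightarrow> (\<forall>x\<in>S. (\<forall>y\<in>S. B x y = 0) \<longrightarrow> x = 0)"

definition orth_pair :: "('a^'n) set \<Rightarrow> 'a^'n \<Rightarrow> 'a^'n \<Rightarrow> ('a^'n) set" where
  "orth_pair S s t = {x \<in> S. B x s = 0 \<and> B x t = 0}"

definition symplectic_pair_perp :: "('a^'n) set \<Rightarrow> 'a^'n \<Rightarrow> 'a^'n \<Rightarrow> bool" where
  "symplectic_pair_perp X e f \<longleftrightarrow> B e f = 1 \<and> (\<forall>x\<in>X. B x e = 0 \<and> B x f = 0)"

lemma subspace_orth_pair: "vec.subspace S \<Longrightarrow> vec.subspace (orth_pair S s t)"
  unfolding orth_pair_def vec.subspace_def by auto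

lemma symplectic_pair_perp_orth_pair:
  "B s t = 1 \<Longrightarrow> symplectic_pair_perp (orth_pair S s t) s t"
  unfolding symplectic_pair_perp_def orth_pair_def by simp

lemma symplectic_pair_perp_mono:
  "symplectic_pair_perp X e f \<Longrightarrow> X' \<subseteq> X \<Longrightarrow> symplectic_pair_perp X' e f"
  unfolding symplectic_pair_perp_def by blast

lemma dim_plane_sum:
  assumes X: "vec.subspace X" and ef: "symplectic_pair_perp X e f"
  shows "vec.dim (plane_sum e f X) = vec.dim X + 2"
proof -
  have span_X: "vec.span X = X" using X by (simp add: vec.span_eq_iff)
  have "f \<notin> vec.span X"
    using ef unfolding span_X symplectic_pair_perp_def by (auto simp: polar_commute[of f e])
  moreover have "e \<notin> vec.span (insert f X)"
  proof
    assume "e \<in> vec.span (insert f X)"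
    then obtain k where "e + k *s f \<in> X" unfolding vec.span_insert span_X by auto
    then have "B (e + k *s f) f = 0" using ef unfolding symplectic_pair_perp_def by blast
    then show False using ef unfolding symplectic_pair_perp_def by simp
  qed
  ultimately show ?thesis by (simp add: plane_sum_eq_span[OF X] vec.dim_insert)
qed

lemma plane_sum_orth_pair:
  assumes S: "vec.subspace S" and "s \<in> S" "t \<in> S" and st: "B s t = 1"
  shows "S = plane_sum s t (orth_pair S s t)"
proof (intro set_eqI iffI)
  fix x assume x: "x \<in> S"
  let ?x' = "x + B x t *s s + B x s *s t"
  have "?x' \<in> orth_pair S s t"
    using S assms(2,3) x st
    by (simp add: orth_pair_def vec.subspace_add vec.subspace_scale polar_commute[of t s])
  moreover have "x = B x t *s s + B x s *s t + ?x'" by (simp add: algebra_simps)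
  ultimately show "x \<in> plane_sum s t (orth_pair S s t)" unfolding plane_sum_def by blast
next
  fix x assume "x \<in> plane_sum s t (orth_pair S s t)"
  then show "x \<in> S" unfolding plane_sum_def orth_pair_def using S assms(2,3)
    by (auto intro!: vec.subspace_add vec.subspace_scale)
qed

lemma dim_orth_pair:
  assumes "vec.subspace S" "s \<in> S" "t \<in> S" "B s t = 1"
  shows "vec.dim S = vec.dim (orth_pair S s t) + 2"
  using dim_plane_sum[OF subspace_orth_pair symplectic_pair_perp_orth_pair] plane_sum_orth_pair assms
  by metis

lemma nondeg_orth_pair:
  assumes S: "vec.subspace S" "s \<in> S" "t \<in> S" "B s t = 1" and nd: "nondeg S"
  shows "nondeg (orth_pair S s t)"
  unfolding nondeg_def
proof (intro ballI impI)
  fix x assume x: "x \<in> orth_pair S s t" and perp: "\<forall>y\<in>orth_pair S s t. B x y = 0"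
  have "B x y = 0" if "y \<in> S" for y
  proof -
    have "y \<in> plane_sum s t (orth_pair S s t)" using plane_sum_orth_pair[OF S] that by metis
    then obtain a b z where "y = a *s s + b *s t + z" "z \<in> orth_pair S s t"
      unfolding plane_sum_def by blast
    then show ?thesis using x perp unfolding orth_pair_def by (simp add: polar_commute[of x])
  qed
  then show "x = 0" using nd x unfolding nondeg_def orth_pair_def by blast
qed

lemma obtain_symplectic_partner:
  assumes "vec.subspace S" "nondeg S" "s \<in> S" "s \<noteq> 0"
  obtains t where "t \<in> S" "B s t = 1"
proof -
  obtain t where "t \<in> S" "B s t \<noteq> 0" using assms unfolding nondeg_def by blast
  then show ?thesis
    using that[of "inverse (B s t) *s t"] assms(1) by (simp add: vec.subspace_scale)
qed

lemma even_dim_nondeg: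
  assumes "vec.subspace S" "nondeg S"
  shows "even (vec.dim S)"
  using assms
proof (induction "vec.dim S" arbitrary: S rule: less_induct)
  case less
  show ?case
  proof (cases "S \<subseteq> {0}")
    case False
    then obtain s where s: "s \<in> S" "s \<noteq> 0" by blast
    then obtain t where t: "t \<in> S" "B s t = 1" using obtain_symplectic_partner less.prems by blast
    note dim_S = dim_orth_pair[OF less.prems(1) s(1) t]
    have "even (vec.dim (orth_pair S s t))"
      using dim_S subspace_orth_pair[OF less.prems(1)] nondeg_orth_pair[OF less.prems(1) s(1) t]
        less.prems(2) by (intro less.hyps) auto
    then show ?thesis using dim_S by simp
  next
    case True
    then have "vec.dim S = 0" by simp
    then show ?thesis by (simp only: even_zero)
  qed
qed

lemma totally_singular_zero: "totally_singular Q {0}"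
  unfolding totally_singular_def by simp

lemma polar_totally_singular:
  assumes "totally_singular Q U" "u \<in> U" "v \<in> U"
  shows "B u v = 0"
proof -
  have "u + v \<in> U" using assms unfolding totally_singular_def by (simp add: vec.subspace_add)
  then have "Q (u + v) = 0" "Q u = 0" "Q v = 0" using assms unfolding totally_singular_def by blast+
  then show ?thesis by simp
qed

lemma finite_witt_dims: "finite {vec.dim U | U. U \<subseteq> W \<and> totally_singular Q U}"
proof (rule finite_subset)
  show "{vec.dim U | U. U \<subseteq> W \<and> totally_singular Q U} \<subseteq> {..vec.dim (UNIV :: ('a^'n) set)}"
    using vec.dim_subset[OF subset_UNIV] by auto
qed simp

lemma witt_index_ge: "U \<subseteq> W \<Longrightarrow> totally_singular Q U \<Longrightarrow> vec.dim U \<le> witt_index Q W"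
  unfolding witt_index_def by (rule Max_ge[OF finite_witt_dims]) blast

lemma witt_index_attained:
  assumes "vec.subspace W"
  obtains U where "U \<subseteq> W" "totally_singular Q U" "vec.dim U = witt_index Q W"
proof -
  have "{0} \<subseteq> W" using assms by (simp add: vec.subspace_0)
  then have "{vec.dim U | U. U \<subseteq> W \<and> totally_singular Q U} \<noteq> {}"
    using totally_singular_zero by blast
  then have "witt_index Q W \<in> {vec.dim U | U. U \<subseteq> W \<and> totally_singular Q U}"
    unfolding witt_index_def by (rule Max_in[OF finite_witt_dims])
  then show ?thesis using that by auto
qed

lemma witt_index_eqI:
  assumes W: "vec.subspace W" and "U \<subseteq> W" "totally_singular Q U" "vec.dim U = k"
    and "\<And>U. U \<subseteq> W \<Longrightarrow> totally_singular Q U \<Longrightarrow> vec.dim U \<le> k"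
  shows "witt_index Q W = k"
proof -
  obtain U' where U': "U' \<subseteq> W" "totally_singular Q U'" "vec.dim U' = witt_index Q W"
    using witt_index_attained[OF W] by blast
  have "k \<le> witt_index Q W" using witt_index_ge[OF assms(2,3)] assms(4) by simp
  moreover have "witt_index Q W \<le> k" using assms(5)[OF U'(1,2)] U'(3) by simp
  ultimately show ?thesis by simp
qed

lemma witt_index_anisotropic:
  assumes W: "vec.subspace W" and "\<And>w. w \<in> W \<Longrightarrow> Q w = 0 \<Longrightarrow> w = 0"
  shows "witt_index Q W = 0"
proof (rule witt_index_eqI[OF W, of "{0}"])
  show "{0} \<subseteq> W" using W by (simp add: vec.subspace_0)
  fix U assume "U \<subseteq> W" "totally_singular Q U"
  then have "U \<subseteq> {0}" using assms(2) unfolding totally_singular_def by blast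
  then show "vec.dim U \<le> 0" by simp
qed (simp_all add: totally_singular_zero)

lemma witt_index_zero: "witt_index Q {0} = 0"
  by (rule witt_index_anisotropic) auto

lemma totally_singular_insert:
  assumes U: "totally_singular Q U" and "Q e = 0" "\<And>x. x \<in> U \<Longrightarrow> B x e = 0"
  shows "totally_singular Q (vec.span (insert e U))"
  unfolding totally_singular_def
proof (intro conjI ballI)
  have span_U: "vec.span U = U" using U unfolding totally_singular_def by (simp add: vec.span_eq_iff)
  fix y assume "y \<in> vec.span (insert e U)"
  then obtain k where "y + k *s e \<in> U" unfolding vec.span_insert span_U by auto
  moreover define z where "z = y + k *s e"
  ultimately have "Q z = 0" "B z e = 0" using U assms(3) unfolding totally_singular_def by blast+
  moreover have "y = z + k *s e" unfolding z_def by (simp add: add.assoc)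
  ultimately show "Q y = 0" using assms(2) by simp
qed simp

lemma obtain_subspace_perp_avoiding_line:
  assumes V: "totally_singular Q V" and ef: "B e f = 1"
  obtains V' where "V' \<subseteq> V" "vec.subspace V'" "vec.dim V \<le> vec.dim V' + 1"
    "\<And>v. v \<in> V' \<Longrightarrow> B v e = 0" "\<And>v k. v \<in> V' \<Longrightarrow> v = k *s e \<Longrightarrow> v = 0"
proof -
  have V_sub: "vec.subspace V" using V unfolding totally_singular_def by simp
  have kernel_subspace: "vec.subspace {v \<in> V. B v x = 0}" for x
    using V_sub unfolding vec.subspace_def by simp
  have kernel_dim: "vec.dim V \<le> vec.dim {v \<in> V. B v x = 0} + 1" for x
    by (rule dim_le_dim_kernel_plus_one[OF V_sub]) simp_all
  show ?thesis
  proof (cases "e \<in> V")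
    case False
    show ?thesis
    proof (rule that[of "{v \<in> V. B v e = 0}"])
      fix v k assume v: "v \<in> {v \<in> V. B v e = 0}" "v = k *s e"
      show "v = 0"
      proof (cases "k = 0")
        case False
        then have "e = inverse k *s v" using v(2) by simp
        then have "e \<in> V" using v(1) V_sub by (simp add: vec.subspace_scale)
        then show ?thesis using \<open>e \<notin> V\<close> by simp
      qed (use v in simp)
    qed (use kernel_subspace kernel_dim in auto)
  next
    case True
    show ?thesis
    proof (rule that[of "{v \<in> V. B v f = 0}"])
      fix v assume v: "v \<in> {v \<in> V. B v f = 0}"
      then show "B v e = 0" using polar_totally_singular[OF V _ True] by blast
      fix k assume "v = k *s e"
      then show "v = 0" using v ef by simp
    qed (use kernel_subspace kernel_dim in auto)
  qed
qed
text \<open>In characteristic 2 this is w - B(w,f) e - B(w,e) f, the projection onto the orthogonal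
  complement of a pair with B e f = 1.\<close>

definition perp_projection :: "'a^'n \<Rightarrow> 'a^'n \<Rightarrow> 'a^'n \<Rightarrow> 'a^'n" where
  "perp_projection e f w = w + B w f *s e + B w e *s f"

lemma linear_perp_projection: "Vector_Spaces.linear (*s) (*s) (perp_projection e f)"
  unfolding Vector_Spaces.linear_iff perp_projection_def
  by (simp add: vec.vector_space_axioms vec_eq_iff algebra_simps)

lemma perp_projection_in:
  assumes "symplectic_pair_perp X e f" "w \<in> plane_sum e f X"
  shows "perp_projection e f w \<in> X"
proof -
  obtain a b x where w: "w = a *s e + b *s f + x" "x \<in> X"
    using assms(2) unfolding plane_sum_def by blast
  have "B e f = 1" "B f e = 1" "B x e = 0" "B x f = 0"
    using assms(1) w(2) unfolding symplectic_pair_perp_def by (auto simp: polar_commute[of f e])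
  then have "perp_projection e f w = x"
    unfolding w(1) perp_projection_def by (simp add: vec_eq_iff algebra_simps)
  then show ?thesis using w(2) by simp
qed

lemma dim_totally_singular_plane_sum_le:
  assumes X: "vec.subspace X" and e: "Q e = 0" and f: "Q f = 0"
    and ef: "symplectic_pair_perp X e f"
    and V: "V \<subseteq> plane_sum e f X" "totally_singular Q V"
  shows "vec.dim V \<le> witt_index Q X + 1"
proof -
  let ?\<pi> = "perp_projection e f"
  note lin = linear_perp_projection[of e f]
  have Bef: "B e f = 1" using ef unfolding symplectic_pair_perp_def by simp
  obtain V' where V': "V' \<subseteq> V" "vec.subspace V'" "vec.dim V \<le> vec.dim V' + 1"
    "\<And>v. v \<in> V' \<Longrightarrow> B v e = 0" "\<And>v k. v \<in> V' \<Longrightarrow> v = k *s e \<Longrightarrow> v = 0"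
    using obtain_subspace_perp_avoiding_line[OF V(2) Bef] by blast
  have "inj_on ?\<pi> V'"
  proof (subst vec.linear_inj_on_iff_eq_0[OF lin V'(2)], intro ballI impI)
    fix v assume v: "v \<in> V'" "?\<pi> v = 0"
    then have "v = B v f *s e" using V'(4)[OF v(1)] unfolding perp_projection_def by simp
    then show "v = 0" using V'(5) v(1) by blast
  qed
  moreover have "vec.span V' = V'" using V'(2) by (simp add: vec.span_eq_iff)
  ultimately have "inj_on ?\<pi> (vec.span V')" by (simp only:)
  then have "vec.dim (?\<pi> ` V') = vec.dim V'" by (rule vec.dim_image_eq[OF lin])
  moreover have "totally_singular Q (?\<pi> ` V')"
    unfolding totally_singular_def
  proof (intro conjI ballI)
    show "vec.subspace (?\<pi> ` V')" by (rule vec.linear_subspace_image[OF lin V'(2)])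
    fix y assume "y \<in> ?\<pi> ` V'"
    then obtain v where v: "v \<in> V'" "y = ?\<pi> v" by blast
    have "Q v = 0" using V(2) V'(1) v(1) unfolding totally_singular_def by blast
    then show "Q y = 0" using V'(4)[OF v(1)] unfolding v(2) perp_projection_def by (simp add: e f Bef)
  qed
  moreover have "?\<pi> ` V' \<subseteq> X" using perp_projection_in[OF ef] V(1) V'(1) by blast
  ultimately have "vec.dim V' \<le> witt_index Q X" using witt_index_ge by metis
  then show ?thesis using V'(3) by simp
qed

lemma witt_index_plane_sum_hyperbolic:
  assumes X: "vec.subspace X" and e: "Q e = 0" and f: "Q f = 0"
    and ef: "symplectic_pair_perp X e f"
  shows "witt_index Q (plane_sum e f X) = witt_index Q X + 1"
proof -
  obtain U where U: "U \<subseteq> X" "totally_singular Q U" "vec.dim U = witt_index Q X"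
    using witt_index_attained[OF X] by blast
  have span_U: "vec.span U = U" using U(2) unfolding totally_singular_def by (simp add: vec.span_eq_iff)
  have "e \<notin> U" using ef U(1) unfolding symplectic_pair_perp_def by fastforce
  then have "e \<notin> vec.span U" unfolding span_U .
  then have "vec.dim (vec.span (insert e U)) = witt_index Q X + 1"
    using U(3) by (simp add: vec.dim_insert)
  moreover have "vec.span (insert e U) \<subseteq> plane_sum e f X"
  proof (rule vec.span_minimal)
    have "e = 1 *s e + 0 *s f + 0" by simp
    then have "e \<in> plane_sum e f X" unfolding plane_sum_def using vec.subspace_0[OF X] by blast
    then show "insert e U \<subseteq> plane_sum e f X" using U(1) subset_plane_sum[OF X] by blast
  qed (rule subspace_plane_sum[OF X])
  moreover have "totally_singular Q (vec.span (insert e U))"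
    using ef U(1,2) e unfolding symplectic_pair_perp_def by (blast intro: totally_singular_insert)
  ultimately show ?thesis
    using witt_index_eqI[OF subspace_plane_sum[OF X]] dim_totally_singular_plane_sum_le[OF assms]
    by blast
qed

lemma exists_singular_vector:
  assumes Y: "vec.subspace Y" and dim_Y: "3 \<le> vec.dim Y"
  shows "\<exists>e\<in>Y. e \<noteq> 0 \<and> Q e = 0"
proof -
  have "\<not> Y \<subseteq> {0}"
  proof
    assume "Y \<subseteq> {0}"
    then have "vec.dim Y = 0" by (simp only: vec.dim_eq_0)
    then show False using dim_Y by linarith
  qed
  then obtain w where w: "w \<in> Y" "w \<noteq> 0" by blast
  let ?K = "{y \<in> Y. B y w = 0}"
  have "vec.dim Y \<le> vec.dim ?K + 1" by (rule dim_le_dim_kernel_plus_one[OF Y]) simp_all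
  moreover have "vec.dim (vec.span {w}) \<le> 1" using vec.dim_insert[of w "{}"] by simp
  ultimately have "\<not> ?K \<subseteq> vec.span {w}" using dim_Y vec.dim_subset[of ?K "vec.span {w}"] by linarith
  then obtain x where x: "x \<in> Y" "B x w = 0" "x \<notin> vec.span {w}" by blast
  show ?thesis
  proof (cases "Q w = 0")
    case False
    obtain t where t: "t^2 = Q x / Q w" using exists_square_root by blast
    have "Q (t *s w + x) = 0" using t False x(2) by (simp add: polar_commute[of w x])
    moreover have "t *s w + x \<in> Y" using Y w x by (simp add: vec.subspace_add vec.subspace_scale)
    moreover have "t *s w + x \<noteq> 0"
    proof
      assume "t *s w + x = 0"
      then have "x = t *s w" by simp
      then show False using x(3) by (simp add: vec.span_scale vec.span_base)
    qed
    ultimately show ?thesis by blast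
  qed (use w in blast)
qed

lemma obtain_hyperbolic_partner:
  assumes S: "vec.subspace S" "nondeg S" and e: "e \<in> S" "e \<noteq> 0" "Q e = 0"
  obtains f where "f \<in> S" "Q f = 0" "B e f = 1"
proof -
  obtain t where t: "t \<in> S" "B e t = 1" using obtain_symplectic_partner[OF S e(1,2)] .
  show ?thesis
  proof (rule that[of "t + Q t *s e"])
    show "t + Q t *s e \<in> S" using S(1) t(1) e(1) by (simp add: vec.subspace_add vec.subspace_scale)
  qed (use t e in \<open>simp_all add: polar_commute[of t e]\<close>)
qed

text \<open>The sums p1 + y1 and p2 + y2 of corresponding basis vectors are singular.\<close>

lemma witt_index_twin_planes:
  assumes p12: "B p1 p2 = 1" and y12: "B y1 y2 = 1"
    and perp: "B p1 y1 = 0" "B p1 y2 = 0" "B p2 y1 = 0" "B p2 y2 = 0"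
    and q1: "Q p1 = Q y1" and q2: "Q p2 = Q y2"
  shows "witt_index Q (plane_sum p1 p2 (plane_sum y1 y2 {0})) = 2"
proof -
  have perp': "B y1 p1 = 0" "B y2 p1 = 0" "B y1 p2 = 0" "B y2 p2 = 0" "B p2 p1 = 1" "B y2 y1 = 1"
    using perp p12 y12 by (simp_all add: polar_commute)
  define e where "e = y1 + p1"
  define f where "f = y2 + Q y2 *s e"
  define x where "x = p2 + y2"
  define g where "g = p1 + Q p1 *s x"
  have Qe: "Q e = 0" unfolding e_def using perp' q1 by simp
  have Bef: "B e f = 1" unfolding f_def e_def using perp perp' y12 by simp
  have Qf: "Q f = 0" unfolding f_def using Qe perp' by (simp add: e_def)
  have Qx: "Q x = 0" unfolding x_def using perp q2 by simp
  have Bxg: "B x g = 1" unfolding g_def x_def using perp perp' by simp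
  have Qg: "Q g = 0" unfolding g_def using Qx perp p12 by (simp add: x_def)
  have perp_ef: "B x e = 0" "B x f = 0" "B g e = 0" "B g f = 0"
    unfolding g_def f_def x_def e_def using perp perp' p12 y12 by simp_all
  have X: "vec.subspace (plane_sum x g {0})" by (simp add: subspace_plane_sum)
  have "witt_index Q (plane_sum x g {0}) = 1"
    using witt_index_plane_sum_hyperbolic[of "{0}" x g] Qx Qg Bxg witt_index_zero
    by (simp add: symplectic_pair_perp_def)
  moreover have "symplectic_pair_perp (plane_sum x g {0}) e f"
    using Bef perp_ef unfolding symplectic_pair_perp_def plane_sum_def by auto
  ultimately have "witt_index Q (plane_sum e f (plane_sum x g {0})) = 2"
    using witt_index_plane_sum_hyperbolic[OF X Qe Qf] by simp
  moreover have "vec.span {p1, p2, y1, y2} = vec.span {e, f, x, g}"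
  proof -
    let ?E = "vec.span {e, f, x, g}" and ?P = "vec.span {p1, p2, y1, y2}"
    have "g + Q p1 *s x \<in> ?E" "x + Q y2 *s e + f \<in> ?E" "e + g + Q p1 *s x \<in> ?E" "f + Q y2 *s e \<in> ?E"
      by (intro vec.span_add vec.span_scale vec.span_base; simp)+
    moreover have "p1 = g + Q p1 *s x" "p2 = x + Q y2 *s e + f" "y1 = e + g + Q p1 *s x" "y2 = f + Q y2 *s e"
      unfolding e_def f_def x_def g_def by (simp_all add: algebra_simps)
    ultimately have sub1: "{p1, p2, y1, y2} \<subseteq> ?E" by (metis empty_subsetI insert_subset)
    have "y1 + p1 \<in> ?P" "y2 + Q y2 *s (y1 + p1) \<in> ?P" "p2 + y2 \<in> ?P" "p1 + Q p1 *s (p2 + y2) \<in> ?P"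
      by (intro vec.span_add vec.span_scale vec.span_base; simp)+
    then have sub2: "{e, f, x, g} \<subseteq> ?P" unfolding e_def f_def x_def g_def by simp
    show ?thesis unfolding vec.span_eq using sub1 sub2 by blast
  qed
  ultimately show ?thesis by (simp add: plane_sum_plane_sum_zero)
qed

lemma witt_index_anisotropic_plane:
  assumes p12: "B p1 p2 = 1" and q1: "Q p1 = 1" and q2: "Q p2 = c"
    and c: "\<And>t. t^2 + t \<noteq> c"
  shows "witt_index Q (plane_sum p1 p2 {0}) = 0"
proof (rule witt_index_anisotropic)
  show "vec.subspace (plane_sum p1 p2 {0})" by (simp add: subspace_plane_sum)
  fix w assume "w \<in> plane_sum p1 p2 {0}" "Q w = 0"
  then obtain a b where w: "w = a *s p1 + b *s p2" "a^2 + a * b + b^2 * c = 0"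
    using p12 q1 q2 unfolding plane_sum_def by (auto simp: algebra_simps)
  have "b = 0"
  proof (rule ccontr)
    assume "b \<noteq> 0"
    then have "(a/b)^2 + a/b + c = (a^2 + a * b + b^2 * c) / b^2"
      by (simp add: field_simps power2_eq_square)
    then show False using w(2) c by simp
  qed
  then show "w = 0" using w by simp
qed

definition witt_index_forced :: "('a^'n) set \<Rightarrow> nat \<Rightarrow> bool" where
  "witt_index_forced Y d \<longleftrightarrow> (\<exists>\<alpha> \<beta>. \<forall>p1 p2. symplectic_pair_perp Y p1 p2 \<longrightarrow>
     Q p1 = \<alpha> \<longrightarrow> Q p2 = \<beta> \<longrightarrow> witt_index Q (plane_sum p1 p2 Y) = d)"

lemma witt_index_forced_hyperbolic:
  assumes "vec.subspace Y"
  shows "witt_index_forced Y (witt_index Q Y + 1)"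
  unfolding witt_index_forced_def
  using witt_index_plane_sum_hyperbolic[OF assms] by (intro exI[of _ 0]) simp

lemma witt_index_forced_zero: "witt_index_forced {0} 0"
proof -
  obtain c :: 'a where c: "\<And>t. t^2 + t \<noteq> c" using exists_not_artin_schreier by blast
  show ?thesis
    unfolding witt_index_forced_def symplectic_pair_perp_def
    using witt_index_anisotropic_plane[OF _ _ _ c] by (intro exI[of _ 1] exI[of _ c]) simp
qed

lemma witt_index_forced_anisotropic_plane:
  assumes Y: "vec.subspace Y" "nondeg Y" "vec.dim Y = 2"
  shows "witt_index_forced Y 2"
proof -
  have "\<not> Y \<subseteq> {0}"
  proof
    assume "Y \<subseteq> {0}"
    then have "vec.dim Y = 0" by (simp only: vec.dim_eq_0)
    then show False using Y(3) by simp
  qed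
  then obtain y1 where y1: "y1 \<in> Y" "y1 \<noteq> 0" by blast
  obtain y2 where y2: "y2 \<in> Y" "B y1 y2 = 1" using obtain_symplectic_partner[OF Y(1,2) y1] .
  have "vec.dim (orth_pair Y y1 y2) = 0" using dim_orth_pair[OF Y(1) y1(1) y2] Y(3) by simp
  then have "orth_pair Y y1 y2 = {0}"
    using vec.subspace_0[OF subspace_orth_pair[OF Y(1)]] by (auto simp only: vec.dim_eq_0)
  then have Y_eq: "Y = plane_sum y1 y2 {0}" using plane_sum_orth_pair[OF Y(1) y1(1) y2] by metis
  show ?thesis
    unfolding witt_index_forced_def
  proof (rule exI[of _ "Q y1"], rule exI[of _ "Q y2"], intro allI impI)
    fix p1 p2 assume p: "symplectic_pair_perp Y p1 p2" "Q p1 = Q y1" "Q p2 = Q y2"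
    then have "B p1 p2 = 1" "B p1 y1 = 0" "B p1 y2 = 0" "B p2 y1 = 0" "B p2 y2 = 0"
      using y1(1) y2(1) polar_commute unfolding symplectic_pair_perp_def by metis+
    then have "witt_index Q (plane_sum p1 p2 (plane_sum y1 y2 {0})) = 2"
      using witt_index_twin_planes y2(2) p(2,3) by blast
    then show "witt_index Q (plane_sum p1 p2 Y) = 2" using Y_eq by simp
  qed
qed

lemma witt_index_forced_orth_pair:
  assumes Y: "vec.subspace Y" and e: "e \<in> Y" "Q e = 0" and f: "f \<in> Y" "Q f = 0" "B e f = 1"
    and forced: "witt_index_forced (orth_pair Y e f) d"
  shows "witt_index_forced Y (d + 1)"
proof -
  let ?Y = "orth_pair Y e f"
  have "witt_index Q (plane_sum p1 p2 Y) = witt_index Q (plane_sum p1 p2 ?Y) + 1"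
    if p: "symplectic_pair_perp Y p1 p2" for p1 p2
  proof -
    have "Y = plane_sum e f ?Y" by (rule plane_sum_orth_pair[OF Y e(1) f(1,3)])
    then have "plane_sum p1 p2 Y = plane_sum e f (plane_sum p1 p2 ?Y)"
      using plane_sum_commute by metis
    moreover have "B p1 e = 0" "B p2 e = 0" "B p1 f = 0" "B p2 f = 0"
      using p e(1) f(1) polar_commute unfolding symplectic_pair_perp_def by metis+
    then have "symplectic_pair_perp (plane_sum p1 p2 ?Y) e f"
      using f(3) unfolding symplectic_pair_perp_def plane_sum_def orth_pair_def by auto
    ultimately show ?thesis
      using witt_index_plane_sum_hyperbolic[OF subspace_plane_sum[OF subspace_orth_pair[OF Y]] e(2) f(2)]
      by simp
  qed
  moreover have "symplectic_pair_perp ?Y p1 p2" if "symplectic_pair_perp Y p1 p2" for p1 p2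
    using that by (rule symplectic_pair_perp_mono) (auto simp: orth_pair_def)
  ultimately show ?thesis using forced unfolding witt_index_forced_def by metis
qed

text \<open>Splitting off hyperbolic planes leaves either 0 or an anisotropic plane.\<close>

lemma witt_index_forced_nondeg:
  assumes "vec.subspace Y" "nondeg Y" "vec.dim Y = 2 * k" "d = k \<or> d = k + 1"
  shows "witt_index_forced Y d"
  using assms
proof (induction k arbitrary: Y d)
  case 0
  then have "Y = {0}" using vec.subspace_0 by auto
  then show ?case using 0 witt_index_forced_zero witt_index_forced_hyperbolic[of "{0}"]
    by (auto simp: witt_index_zero)
next
  case (Suc k)
  note Y = Suc.prems(1) and nd = Suc.prems(2) and dim_Y = Suc.prems(3)
  show ?case
  proof (cases "\<exists>e\<in>Y. e \<noteq> 0 \<and> Q e = 0")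
    case True
    then obtain e where e: "e \<in> Y" "e \<noteq> 0" "Q e = 0" by blast
    obtain f where f: "f \<in> Y" "Q f = 0" "B e f = 1"
      using obtain_hyperbolic_partner[OF Y nd e] by blast
    have "witt_index_forced (orth_pair Y e f) (d - 1)"
      using Suc.IH[of "orth_pair Y e f" "d - 1"] Suc.prems(4) subspace_orth_pair[OF Y]
        nondeg_orth_pair[OF Y e(1) f(1,3) nd] dim_orth_pair[OF Y e(1) f(1,3)] dim_Y by auto
    then show ?thesis
      using witt_index_forced_orth_pair[OF Y e(1,3) f] Suc.prems(4) by fastforce
  next
    case False
    then have "\<not> 3 \<le> vec.dim Y" using exists_singular_vector[OF Y] by blast
    then have "k = 0" "vec.dim Y = 2" using dim_Y by simp_all
    moreover have "witt_index Q Y = 0" using witt_index_anisotropic[OF Y] False by blast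
    ultimately show ?thesis
      using Suc.prems(4) witt_index_forced_hyperbolic[OF Y] witt_index_forced_anisotropic_plane[OF Y nd]
      by (auto simp: numeral_2_eq_2)
  qed
qed

end

context
  fixes g :: "'a::field^'n^'n"
begin

lemma funpow_mat_vec_zero: "(((*v) g) ^^ i) 0 = 0"
  by (induction i) simp_all

lemma poly_mat_apply_degree_le:
  "degree p \<le> N \<Longrightarrow> poly_mat_apply p g v = (\<Sum>i\<le>N. coeff p i *s (((*v) g) ^^ i) v)"
  unfolding poly_mat_apply_def by (rule sum.mono_neutral_left) (auto simp: coeff_eq_0)

lemma poly_mat_apply_add: "poly_mat_apply (p + q) g v = poly_mat_apply p g v + poly_mat_apply q g v"
proof -
  let ?N = "max (degree p) (degree q)"
  have "degree (p + q) \<le> ?N" by (rule degree_add_le) auto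
  then show ?thesis
    by (simp add: poly_mat_apply_degree_le[of _ ?N] vector_sadd_rdistrib sum.distrib)
qed

lemma poly_mat_apply_smult: "poly_mat_apply (smult a p) g v = a *s poly_mat_apply p g v"
  using poly_mat_apply_degree_le[OF degree_smult_le, of a p v] poly_mat_apply_degree_le[OF order_refl, of p v]
  by (simp add: vec.scale_sum_right)

lemma poly_mat_apply_pCons:
  "poly_mat_apply (pCons a p) g v = a *s v + poly_mat_apply p g (g *v v)"
proof -
  have "poly_mat_apply (pCons a p) g v =
      (\<Sum>i\<le>Suc (degree p). coeff (pCons a p) i *s (((*v) g) ^^ i) v)"
    by (rule poly_mat_apply_degree_le) (simp add: degree_pCons_le)
  also have "\<dots> = a *s v + (\<Sum>i\<le>degree p. coeff p i *s (((*v) g) ^^ Suc i) v)"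
    by (subst sum.atMost_Suc_shift) simp
  also have "\<dots> = a *s v + poly_mat_apply p g (g *v v)"
    unfolding poly_mat_apply_def by (simp add: funpow_Suc_right del: funpow.simps)
  finally show ?thesis .
qed

lemma poly_mat_apply_zero [simp]: "poly_mat_apply 0 g v = 0" "poly_mat_apply p g 0 = 0"
  unfolding poly_mat_apply_def by (simp_all add: funpow_mat_vec_zero)

lemma poly_mat_apply_one [simp]: "poly_mat_apply 1 g v = v"
  unfolding poly_mat_apply_def by simp

lemma poly_mat_apply_linear_factor: "poly_mat_apply [:-1, 1:] g v = g *v v - v"
  by (simp add: poly_mat_apply_pCons)

lemma poly_mat_apply_commute: "poly_mat_apply p g (g *v v) = g *v poly_mat_apply p g v"
proof -
  have "(((*v) g) ^^ i) (g *v v) = g *v ((((*v) g) ^^ i) v)" for i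
    by (induction i) simp_all
  then show ?thesis unfolding poly_mat_apply_def by (simp add: vec.sum vec.scale)
qed

lemma poly_mat_apply_mult: "poly_mat_apply (p * q) g v = poly_mat_apply p g (poly_mat_apply q g v)"
proof (induction p arbitrary: v rule: pCons_induct)
  case (pCons a p)
  have "poly_mat_apply (pCons a p * q) g v = poly_mat_apply (smult a q + pCons 0 (p * q)) g v"
    by simp
  also have "\<dots> = a *s poly_mat_apply q g v + poly_mat_apply p g (g *v poly_mat_apply q g v)"
    by (simp add: poly_mat_apply_add poly_mat_apply_smult poly_mat_apply_pCons pCons.IH
        poly_mat_apply_commute)
  also have "\<dots> = poly_mat_apply (pCons a p) g (poly_mat_apply q g v)"
    by (simp add: poly_mat_apply_pCons)
  finally show ?case .
qed simp

end

lemma bezout_linear_factor: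
  fixes h :: "'a::field poly"
  assumes "\<not> [:-1, 1:] dvd h"
  shows "\<exists>a b. a * [:-1, 1:] + b * h = 1"
proof -
  define c where "c = poly h 1"
  define q where "q = synthetic_div h 1"
  have "c \<noteq> 0" using assms by (simp add: c_def poly_eq_0_iff_dvd)
  have "[:-1, 1:] * q + [:c:] = h" unfolding c_def q_def by (rule synthetic_div_correct')
  then have h: "h = [:-1, 1:] * q + [:c:]" by (rule sym)
  have "- ([:inverse c:] * q) * [:-1, 1:] + [:inverse c:] * h = [:inverse c:] * [:c:]"
    by (subst h) (simp add: algebra_simps)
  also have "\<dots> = 1" using \<open>c \<noteq> 0\<close> by (simp add: one_pCons)
  finally show ?thesis by blast
qed

text \<open>Squarefreeness of the annihilating polynomial p makes x - 1 coprime to the cofactor h in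
  p dividing (x - 1) h; this coprimality is all that is used of semisimplicity.\<close>

lemma semisimple_bezout:
  fixes g :: "'a::field^'n^'n"
  assumes "semisimple g"
  obtains a b h where "a * [:-1, 1:] + b * h = 1" "\<And>v. poly_mat_apply ([:-1, 1:] * h) g v = 0"
proof -
  obtain p where p: "p \<noteq> 0" "squarefree p" "\<And>v. poly_mat_apply p g v = 0"
    using assms unfolding semisimple_def by blast
  let ?e = "[:-1, 1:] :: 'a poly"
  obtain h where h: "\<not> ?e dvd h" "p dvd ?e * h"
  proof (cases "?e dvd p")
    case True
    then obtain h where ph: "p = ?e * h" by blast
    have "\<not> ?e dvd h"
    proof
      assume "?e dvd h"
      then obtain k where "h = ?e * k" by blast
      then have "p = ?e^2 * k" unfolding ph by (simp only: power2_eq_square mult.assoc)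
      then have "?e^2 dvd p" by (simp only: dvd_triv_left)
      then have "is_unit ?e" using p(2) unfolding squarefree_def by blast
      then show False by (simp add: is_unit_iff_degree)
    qed
    then show ?thesis by (rule that) (simp add: ph)
  next
    case False
    show ?thesis by (rule that[OF False dvd_triv_right])
  qed
  obtain k where k: "?e * h = p * k" using h(2) unfolding dvd_def by blast
  have "poly_mat_apply (?e * h) g v = 0" for v
    unfolding k mult.commute[of p k] by (simp only: poly_mat_apply_mult p(3) poly_mat_apply_zero)
  then show ?thesis using that bezout_linear_factor[OF h(1)] by blast
qed

lemma semisimple_fixed_plus_displacement:
  fixes g :: "'a::field^'n^'n"
  assumes "semisimple g"
  obtains c w where "v = c + (g *v w - w)" "g *v c = c"
proof -
  obtain a b h where abh: "a * [:-1, 1:] + b * h = 1"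
    and ann: "\<And>v. poly_mat_apply ([:-1, 1:] * h) g v = 0"
    using semisimple_bezout[OF assms] by blast
  let ?c = "poly_mat_apply (b * h) g v" and ?w = "poly_mat_apply a g v"
  have "v = poly_mat_apply (a * [:-1, 1:] + b * h) g v" by (simp only: abh poly_mat_apply_one)
  also have "\<dots> = (g *v ?w - ?w) + ?c"
    by (simp only: poly_mat_apply_add mult.commute[of a] poly_mat_apply_mult
        poly_mat_apply_linear_factor)
  finally have "v = ?c + (g *v ?w - ?w)" by (simp only: add.commute)
  moreover have "g *v ?c - ?c = poly_mat_apply ([:-1, 1:] * h) g (poly_mat_apply b g v)"
    by (simp only: poly_mat_apply_linear_factor[symmetric] poly_mat_apply_mult[symmetric] ac_simps)
  then have "g *v ?c = ?c" using ann by simp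
  ultimately show ?thesis using that by blast
qed

lemma semisimple_displacement_fixed:
  fixes g :: "'a::field^'n^'n"
  assumes "semisimple g" and "g *v (g *v w - w) = g *v w - w"
  shows "g *v w = w"
proof -
  obtain a b h where abh: "a * [:-1, 1:] + b * h = 1"
    and ann: "\<And>v. poly_mat_apply ([:-1, 1:] * h) g v = 0"
    using semisimple_bezout[OF assms(1)] by blast
  let ?y = "g *v w - w"
  have "poly_mat_apply [:-1, 1:] g ?y = 0" using assms(2) by (simp add: poly_mat_apply_linear_factor)
  moreover have "poly_mat_apply h g ?y = 0"
    using ann[of w] by (simp only: poly_mat_apply_linear_factor[symmetric]
        poly_mat_apply_mult[symmetric] mult.commute)
  ultimately have "poly_mat_apply (a * [:-1, 1:] + b * h) g ?y = 0"
    by (simp only: poly_mat_apply_add poly_mat_apply_mult poly_mat_apply_zero add_0)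
  then show ?thesis unfolding abh by simp
qed

context char2_quadratic_form
begin

lemma polar_isometry:
  assumes "g \<in> isometry_group Q"
  shows "B (g *v x) (g *v y) = B x y"
  using assms unfolding isometry_group_def polar_form_def
  by (simp add: matrix_vector_right_distrib[symmetric])

lemma polar_fixed_displacement:
  assumes "g \<in> isometry_group Q" "g *v x = x"
  shows "B x (g *v w - w) = 0"
proof -
  have "B x (g *v w) = B x w" using polar_isometry[OF assms(1), of x w] assms(2) by simp
  then show ?thesis by simp
qed

lemma radical_line:
  assumes nonsing: "nonsingular_qf Q" and odd: "odd CARD('n)"
  obtains r where "Q r \<noteq> 0" "radical Q = range (\<lambda>k. k *s r)"
proof -
  have rad: "vec.subspace (radical Q)" unfolding radical_def vec.subspace_def by simp
  have "card (cart_basis :: ('a^'n) set) = CARD('n)" by (rule card_cart_basis)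
  then have "vec.dim (UNIV :: ('a^'n) set) = CARD('n)" using vec.dim_UNIV by simp
  then have "\<not> nondeg UNIV" using even_dim_nondeg[of UNIV] odd by auto
  then obtain r where r: "r \<in> radical Q" "r \<noteq> 0" unfolding nondeg_def radical_def by auto
  then have Q_r: "Q r \<noteq> 0" using nonsing unfolding nonsingular_qf_def by blast
  have "v \<in> range (\<lambda>k. k *s r)" if v: "v \<in> radical Q" for v
  proof -
    obtain t where t: "t^2 = Q v / Q r" using exists_square_root by blast
    have "v + t *s r \<in> radical Q" using v r(1) rad by (simp add: vec.subspace_add vec.subspace_scale)
    moreover have "Q (v + t *s r) = 0" using t Q_r v unfolding radical_def by simp
    ultimately have "v = t *s r" using nonsing unfolding nonsingular_qf_def by auto
    then show ?thesis by blast
  qed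
  moreover have "range (\<lambda>k. k *s r) \<subseteq> radical Q" using r(1) rad by (auto simp: vec.subspace_scale)
  ultimately show ?thesis using that[OF Q_r] by blast
qed

lemma isometry_fixes_radical:
  assumes g: "g \<in> isometry_group Q" and Q_r: "Q r \<noteq> 0"
    and rad: "radical Q = range (\<lambda>k. k *s r)"
  shows "g *v r = r"
proof -
  obtain h where "g ** h = mat 1" using g unfolding isometry_group_def invertible_def by blast
  then have "B (g *v r) v = B r (h *v v)" for v
    using polar_isometry[OF g, of r "h *v v"] by (simp add: matrix_vector_mul_assoc)
  moreover have "r \<in> radical Q" using rad rangeI[of "\<lambda>k. k *s r" 1] by simp
  ultimately have "g *v r \<in> radical Q" unfolding radical_def by simp
  then obtain k where k: "g *v r = k *s r" using rad by blast
  have "Q (g *v r) = Q r" using g unfolding isometry_group_def by blast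
  then have "k^2 = 1^2" using k Q_r by simp
  then have "k = 1" by (rule square_inj)
  then show ?thesis using k by simp
qed

lemma exists_fixed_symplectic_pair:
  assumes g: "g \<in> isometry_group Q" and ss: "semisimple g"
    and fixed: "2 \<le> vec.dim (fixed_space g)" and rad: "radical Q = range (\<lambda>k. k *s r)"
  obtains u c where "g *v u = u" "g *v c = c" "B u c = 1"
proof -
  have "\<not> fixed_space g \<subseteq> vec.span {r}"
  proof
    assume "fixed_space g \<subseteq> vec.span {r}"
    then have "vec.dim (fixed_space g) \<le> vec.dim (vec.span {r})" by (rule vec.dim_subset)
    also have "\<dots> \<le> 1" using vec.dim_insert[of r "{}"] by simp
    finally show False using fixed by simp
  qed
  then obtain u where u: "g *v u = u" "u \<notin> vec.span {r}" unfolding fixed_space_def by blast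
  then have "u \<notin> radical Q" using rad by (auto simp: vec.span_scale vec.span_base)
  then obtain v where v: "B u v \<noteq> 0" unfolding radical_def by blast
  obtain c w where cw: "v = c + (g *v w - w)" "g *v c = c"
    using semisimple_fixed_plus_displacement[OF ss] by blast
  have "B u c \<noteq> 0" using v polar_fixed_displacement[OF g u(1), of w] unfolding cw(1) by simp
  then show ?thesis
    using that[OF u(1), of "inverse (B u c) *s c"] cw(2) by (simp add: vec.scale)
qed

end

locale hyperplane_frame = char2_quadratic_form Q for Q :: "'a::{field,finite}^'n \<Rightarrow> 'a" +
  fixes r u c :: "'a^'n" and Y :: "('a^'n) set"
  assumes radical_eq: "radical Q = range (\<lambda>k. k *s r)" and Q_r: "Q r \<noteq> 0"
    and polar_u_c: "polar_form Q u c = 1" and subspace_Y: "vec.subspace Y"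
    and perp_Y: "\<forall>y\<in>Y. polar_form Q y u = 0 \<and> polar_form Q y c = 0" and r_notin_Y: "r \<notin> Y"
    and spanning: "\<forall>v. \<exists>\<alpha> \<beta> k y. y \<in> Y \<and> v = \<alpha> *s u + \<beta> *s c + k *s r + y"
begin

lemma polar_r [simp]: "B r v = 0" "B v r = 0"
proof -
  have "r \<in> radical Q" using radical_eq rangeI[of "\<lambda>k. k *s r" 1] by simp
  then show "B r v = 0" "B v r = 0" unfolding radical_def by (auto simp: polar_commute[of v])
qed

lemma eq_0_if_radical_in_Y:
  assumes "y \<in> Y" "y \<in> radical Q"
  shows "y = 0"
proof -
  obtain k where k: "y = k *s r" using assms(2) radical_eq by blast
  show ?thesis
  proof (cases "k = 0")
    case False
    then have "r = inverse k *s y" using k by simp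
    then show ?thesis using assms(1) subspace_Y r_notin_Y by (simp add: vec.subspace_scale)
  qed (use k in simp)
qed

lemma nondeg_Y: "nondeg Y"
  unfolding nondeg_def
proof (intro ballI impI)
  fix y assume y: "y \<in> Y" and perp: "\<forall>z\<in>Y. B y z = 0"
  have "B y v = 0" for v
  proof -
    obtain \<alpha> \<beta> k z where "z \<in> Y" "v = \<alpha> *s u + \<beta> *s c + k *s r + z" using spanning by blast
    then show ?thesis using perp perp_Y y by simp
  qed
  then show "y = 0" using eq_0_if_radical_in_Y[OF y] unfolding radical_def by simp
qed

lemma exists_shift_value: "\<exists>a. Q (x + a *s r) = \<gamma>"
proof -
  obtain a where a: "a^2 = (\<gamma> + Q x) / Q r" using exists_square_root by blast
  then have "Q (x + a *s r) = Q x + (\<gamma> + Q x)" using Q_r by simp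
  also have "\<dots> = \<gamma>" by (simp add: add.left_commute)
  finally show ?thesis by blast
qed

lemma symplectic_pair_perp_shift: "symplectic_pair_perp Y (u + a *s r) (c + b *s r)"
  using polar_u_c perp_Y unfolding symplectic_pair_perp_def by simp

lemma nondeg_hyperplane_shift: "nondeg_hyperplane Q (plane_sum (u + a *s r) (c + b *s r) Y)"
  unfolding nondeg_hyperplane_def
proof (intro conjI)
  let ?p = "u + a *s r" and ?q = "c + b *s r"
  show "vec.subspace (plane_sum ?p ?q Y)" by (rule subspace_plane_sum[OF subspace_Y])
  show "plane_sum ?p ?q Y \<inter> radical Q = {0}"
  proof (intro equalityI subsetI)
    fix x assume x: "x \<in> plane_sum ?p ?q Y \<inter> radical Q"
    then obtain \<alpha> \<beta> y where xy: "x = \<alpha> *s ?p + \<beta> *s ?q + y" "y \<in> Y"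
      unfolding plane_sum_def by blast
    have "B x ?q = \<alpha>" "B x ?p = \<beta>"
      using perp_Y xy(2) polar_u_c unfolding xy(1) by (simp_all add: polar_commute[of c u])
    then have "\<alpha> = 0" "\<beta> = 0" using x unfolding radical_def by auto
    then show "x \<in> {0}" using eq_0_if_radical_in_Y xy x by simp
  next
    fix x :: "'a^'n" assume "x \<in> {0}"
    moreover have "0 \<in> plane_sum ?p ?q Y" by (rule vec.subspace_0[OF subspace_plane_sum[OF subspace_Y]])
    moreover have "(0::'a^'n) \<in> radical Q" unfolding radical_def by simp
    ultimately show "x \<in> plane_sum ?p ?q Y \<inter> radical Q" by simp
  qed
  show "{w + r' | w r'. w \<in> plane_sum ?p ?q Y \<and> r' \<in> radical Q} = UNIV"
  proof (intro set_eqI iffI)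
    fix v :: "'a^'n"
    obtain \<alpha> \<beta> k y where v: "y \<in> Y" "v = \<alpha> *s u + \<beta> *s c + k *s r + y" using spanning by blast
    have "\<alpha> *s ?p + \<beta> *s ?q + y \<in> plane_sum ?p ?q Y" using v(1) unfolding plane_sum_def by blast
    moreover have "(\<alpha> * a + \<beta> * b + k) *s r \<in> radical Q" using radical_eq by blast
    moreover have "v = (\<alpha> *s ?p + \<beta> *s ?q + y) + (\<alpha> * a + \<beta> * b + k) *s r"
      unfolding v(2) by (simp add: algebra_simps vec_eq_iff)
    ultimately show "v \<in> {w + r' | w r'. w \<in> plane_sum ?p ?q Y \<and> r' \<in> radical Q}" by blast
  qed simp
qed

lemma exists_invariant_hyperplane:
  assumes g: "invertible g" "\<And>v. g *v v - v \<in> Y"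
    and "vec.dim Y = 2 * k" "d = k \<or> d = k + 1"
  obtains W where "nondeg_hyperplane Q W" "vec.dim W = 2 * k + 2" "witt_index Q W = d"
    "(\<lambda>v. g *v v) ` W = W"
proof -
  obtain \<alpha> \<beta> where forced: "\<And>p1 p2. symplectic_pair_perp Y p1 p2 \<Longrightarrow> Q p1 = \<alpha> \<Longrightarrow> Q p2 = \<beta> \<Longrightarrow>
      witt_index Q (plane_sum p1 p2 Y) = d"
    using witt_index_forced_nondeg[OF subspace_Y nondeg_Y assms(3,4)]
    unfolding witt_index_forced_def by blast
  obtain a b where "Q (u + a *s r) = \<alpha>" "Q (c + b *s r) = \<beta>" using exists_shift_value by metis
  then have "witt_index Q (plane_sum (u + a *s r) (c + b *s r) Y) = d"
    using forced symplectic_pair_perp_shift by blast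
  moreover have "(\<lambda>v. g *v v) ` plane_sum (u + a *s r) (c + b *s r) Y = plane_sum (u + a *s r) (c + b *s r) Y"
    using g subset_plane_sum[OF subspace_Y]
    by (intro image_eq_if_displacements_in subspace_plane_sum[OF subspace_Y]) auto
  moreover have "vec.dim (plane_sum (u + a *s r) (c + b *s r) Y) = 2 * k + 2"
    using dim_plane_sum[OF subspace_Y symplectic_pair_perp_shift] assms(3) by simp
  ultimately show ?thesis using that nondeg_hyperplane_shift by blast
qed

end

context char2_quadratic_form
begin

lemma displacements_perp_fixed:
  assumes "g \<in> isometry_group Q" "g *v u = u" "g *v c = c"
  shows "range (\<lambda>w. g *v w - w) \<subseteq> orth_pair UNIV u c"
proof
  fix x assume "x \<in> range (\<lambda>w. g *v w - w)"
  then obtain w where "x = g *v w - w" by blast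
  then have "B u x = 0" "B c x = 0"
    using polar_fixed_displacement[OF assms(1,2)] polar_fixed_displacement[OF assms(1,3)] by auto
  then show "x \<in> orth_pair UNIV u c" unfolding orth_pair_def by (simp add: polar_commute[of x])
qed

lemma decomposition_orth_pair_complement:
  assumes "B u c = 1" "vec.subspace Y" "orth_pair UNIV u c \<subseteq> vec.span (insert r Y)"
  shows "\<exists>\<alpha> \<beta> k y. y \<in> Y \<and> v = \<alpha> *s u + \<beta> *s c + k *s r + y"
proof -
  have "UNIV = plane_sum u c (orth_pair UNIV u c)" using assms(1) by (intro plane_sum_orth_pair) simp_all
  then have "v \<in> plane_sum u c (orth_pair UNIV u c)" by (metis UNIV_I)
  then obtain \<alpha> \<beta> x where x: "v = \<alpha> *s u + \<beta> *s c + x" "x \<in> orth_pair UNIV u c"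
    unfolding plane_sum_def by blast
  then obtain k where "x + k *s r \<in> Y"
    using assms(2,3) unfolding vec.span_insert vec.span_eq_iff[THEN iffD2, OF assms(2)] by auto
  moreover have "v = \<alpha> *s u + \<beta> *s c + k *s r + (x + k *s r)" using x(1) by (simp add: algebra_simps)
  ultimately show ?thesis by blast
qed

lemma exists_invariant_frame:
  assumes nonsing: "nonsingular_qf Q" and odd: "odd CARD('n)" and g: "g \<in> isometry_group Q"
    and ss: "semisimple g" and fixed: "2 \<le> vec.dim (fixed_space g)"
  obtains r u c Y where "hyperplane_frame Q r u c Y" "\<And>v. g *v v - v \<in> Y"
proof -
  obtain r where Q_r: "Q r \<noteq> 0" and rad: "radical Q = range (\<lambda>k. k *s r)"
    using radical_line[OF nonsing odd] by blast
  have "r \<in> radical Q" using rad rangeI[of "\<lambda>k. k *s r" 1] by simp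
  then have "r \<in> orth_pair UNIV u c" for u c unfolding radical_def orth_pair_def by simp
  obtain u c where u: "g *v u = u" and c: "g *v c = c" and uc: "B u c = 1"
    using exists_fixed_symplectic_pair[OF g ss fixed rad] by blast
  have "r \<notin> range (\<lambda>w. g *v w - w)"
  proof
    assume "r \<in> range (\<lambda>w. g *v w - w)"
    then obtain w where w: "r = g *v w - w" by blast
    then have "g *v (g *v w - w) = g *v w - w" using isometry_fixes_radical[OF g Q_r rad] by simp
    then have "g *v w = w" by (rule semisimple_displacement_fixed[OF ss])
    then show False using w Q_r by simp
  qed
  then obtain Y where Y: "vec.subspace Y" "range (\<lambda>w. g *v w - w) \<subseteq> Y"
    "Y \<subseteq> orth_pair UNIV u c" "r \<notin> Y" "orth_pair UNIV u c \<subseteq> vec.span (insert r Y)"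
    using exists_complement_containing[OF subspace_range_displacement subspace_orth_pair[OF vec.subspace_UNIV]
        displacements_perp_fixed[OF g u c] \<open>r \<in> orth_pair UNIV u c\<close>] by blast
  have "hyperplane_frame Q r u c Y"
    using Y(1,3,4) Q_r rad uc decomposition_orth_pair_complement[OF uc Y(1,5)]
    unfolding orth_pair_def by unfold_locales (auto simp: quadratic two_eq_zero)
  then show ?thesis using that Y(2) by blast
qed

end

theorem mainTheorem18:
  fixes Q :: "'a::{field,finite}^'n \<Rightarrow> 'a"
    and g :: "'a^'n^'n"
    and m :: nat
  assumes q_even: "even CARD('a)"
    and dimV: "CARD('n) = 2 * m + 1"
    and qf: "quadratic_form Q"
    and nonsing: "nonsingular_qf Q"
    and gG: "g \<in> isometry_group Q"
    and ss: "semisimple g"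
    and fix2: "vec.dim (fixed_space g) \<ge> 2"
  shows "(\<exists>W. nondeg_hyperplane Q W \<and> plus_type Q W \<and> (\<lambda>v. g *v v) ` W = W) \<and>
         (\<exists>W. nondeg_hyperplane Q W \<and> minus_type Q W \<and> (\<lambda>v. g *v v) ` W = W)"
proof -
  interpret char2_quadratic_form Q
    using qf two_eq_zero_if_even_card[OF q_even] by unfold_locales
  have "odd CARD('n)" using dimV by simp
  then obtain r u c Y where frame: "hyperplane_frame Q r u c Y" and displacement: "\<And>v. g *v v - v \<in> Y"
    using exists_invariant_frame[OF nonsing _ gG ss fix2] by blast
  interpret hyperplane_frame Q r u c Y by (rule frame)
  obtain k where dim_Y: "vec.dim Y = 2 * k" using even_dim_nondeg[OF subspace_Y nondeg_Y] by blast
  have "invertible g" using gG unfolding isometry_group_def by blast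
  note hyperplane = exists_invariant_hyperplane[OF this displacement dim_Y]
  have "\<exists>W. nondeg_hyperplane Q W \<and> plus_type Q W \<and> (\<lambda>v. g *v v) ` W = W"
    by (rule hyperplane[of "k + 1"]) (auto simp: plus_type_def)
  moreover have "\<exists>W. nondeg_hyperplane Q W \<and> minus_type Q W \<and> (\<lambda>v. g *v v) ` W = W"
    by (rule hyperplane[of k]) (auto simp: minus_type_def)
  ultimately show ?thesis ..
qed
end
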